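(* For all positive integers $a,b$, the ideal of the monomial curve $(t^{a},t^{a+2b},t^{2a+3b},t^{2a+5b})$, i.e. the toric ideal $I_{M_{a,b}}\subseteq K[x_1,x_2,x_3,x_4]$ of the row matrix $M_{a,b}=(a,\,a+2b,\,2a+3b,\,2a+5b)$, is a set-theoretic complete intersection. In particular the ideal of the monomial curve $(t^4,t^6,t^{11},t^{13})$ is a set-theoretic complete intersection.
   Context: $K$ is a field. For a row matrix $(a_1,\dots,a_n)$ of positive integers, its toric ideal is the kernel of $K[x_1,\dots,x_n]\to K[t]$, $x_i\mapsto t^{a_i}$. An ideal $I$ is a set-theoretic complete intersection if $I=\mathrm{rad}(g_1,\dots,g_h)$ for some $h=\mathrm{ht}(I)$ polynomials (here $h=3$). *)

theory Defs
  imports "HOL-Library.Poly_Mapping" "HOL-Computational_Algebra.Polynomial"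
begin

datatype var = X1 | X2 | X3 | X4

text \<open>K[x1,x2,x3,x4]: monomials are finitely supported exponent vectors
  (var =>0 nat), polynomials are finitely supported coefficient functions on monomials
  (multiplication is the convolution product of Poly_Mapping).\<close>
type_synonym 'a mpoly4 = "(var \<Rightarrow>\<^sub>0 nat) \<Rightarrow>\<^sub>0 'a"

definition row4 :: "nat \<Rightarrow> nat \<Rightarrow> nat \<Rightarrow> nat \<Rightarrow> var \<Rightarrow> nat" where
  "row4 a1 a2 a3 a4 v = (case v of X1 \<Rightarrow> a1 | X2 \<Rightarrow> a2 | X3 \<Rightarrow> a3 | X4 \<Rightarrow> a4)"

definition wdeg :: "(var \<Rightarrow> nat) \<Rightarrow> (var \<Rightarrow>\<^sub>0 nat) \<Rightarrow> nat" where
  "wdeg w m = (\<Sum>v\<in>{X1, X2, X3, X4}. w v * Poly_Mapping.lookup m v)"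

text \<open>The K-algebra map K[x1..x4] \<rightarrow> K[t], x_i \<mapsto> t^(a_i).\<close>
definition toric_map :: "(var \<Rightarrow> nat) \<Rightarrow> 'a::comm_ring_1 mpoly4 \<Rightarrow> 'a poly" where
  "toric_map w p = (\<Sum>m\<in>Poly_Mapping.keys p. monom (Poly_Mapping.lookup p m) (wdeg w m))"

definition toric_ideal :: "(var \<Rightarrow> nat) \<Rightarrow> 'a::comm_ring_1 mpoly4 set" where
  "toric_ideal w = {p. toric_map w p = 0}"

definition ideal_gen :: "'a::comm_ring_1 set \<Rightarrow> 'a set" where
  "ideal_gen G = {x. \<exists>F r. finite F \<and> F \<subseteq> G \<and> x = (\<Sum>g\<in>F. r g * g)}"

definition radical :: "'a::comm_ring_1 set \<Rightarrow> 'a set" where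
  "radical I = {x. \<exists>n. x ^ n \<in> I}"

text \<open>Set-theoretic complete intersection, for an ideal of height 3
  (the toric ideal of a monomial curve in 4 variables has height 3).\<close>
definition stci3 :: "'a::comm_ring_1 set \<Rightarrow> bool" where
  "stci3 I \<longleftrightarrow> (\<exists>g1 g2 g3. I = radical (ideal_gen {g1, g2, g3}))"

end

theory Submission
  imports Defs
begin

text \<open>Write \<open>x, y, z, w\<close> for the variables; dividing by the gcd, let \<open>a, b\<close> be coprime.
  The curve lies on the toric surface \<open>(s, s t^2, s^2 t^3, s^2 t^5)\<close>, which is
  set-theoretically cut out by \<open>f = x y^3 - z^2\<close> and \<open>g = y^5 - 2 y z w + x w^2\<close>.
  For \<open>a \<ge> 2\<close> the third equation \<open>h\<close> is the alternating binomial sum of six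
  monomials of bidegrees \<open>(2 a + (5 - i) b, i a)\<close>: modulo the surface,
  \<open>x^(3 a) h = (x^(a + b) - q)^5\<close> for a monomial \<open>q\<close> of bidegree \<open>(a, a)\<close>,
  and \<open>x^(a + b) = q\<close> defines the curve where \<open>x\<close> is invertible. On \<open>x = 0\<close> the equations
  successively force \<open>z = 0\<close>, \<open>y = 0\<close> and, since \<open>h\<close> contains a power of \<open>w\<close>, \<open>w = 0\<close>.
  The semigroup of bidegrees has its only gap at \<open>t\<close>-degree 1, which is why \<open>a = 1\<close> is
  separate; there the curve is the graph of a polynomial map of \<open>x\<close>.\<close>

section \<open>Ideals and radicals\<close>

locale ideal =
  fixes I :: "'r::comm_ring_1 set"
  assumes zero: "0 \<in> I"
    and add: "p \<in> I \<Longrightarrow> q \<in> I \<Longrightarrow> p + q \<in> I"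
    and mult: "p \<in> I \<Longrightarrow> r * p \<in> I"
begin

lemma mult_right: "p \<in> I \<Longrightarrow> p * r \<in> I"
  using mult[of p r] by (simp add: mult.commute)

lemma minus: "p \<in> I \<Longrightarrow> - p \<in> I"
  using mult[of p "- 1"] by simp

lemma diff: "p \<in> I \<Longrightarrow> q \<in> I \<Longrightarrow> p - q \<in> I"
  using add[of p "- q"] minus[of q] by simp

lemma sum: "(\<And>i. i \<in> A \<Longrightarrow> f i \<in> I) \<Longrightarrow> sum f A \<in> I"
  by (induction A rule: infinite_finite_induct) (auto intro: zero add)

lemma power: "p \<in> I \<Longrightarrow> n > 0 \<Longrightarrow> p ^ n \<in> I"
  by (cases n) (auto intro: mult_right)

lemma cong_refl: "p - p \<in> I"
  by (simp add: zero)

lemma cong_sym: "p - q \<in> I \<Longrightarrow> q - p \<in> I"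
  using minus[of "p - q"] by simp

lemma cong_trans: "p - q \<in> I \<Longrightarrow> q - r \<in> I \<Longrightarrow> p - r \<in> I"
  using add[of "p - q" "q - r"] by simp

lemma cong_mem: "p - q \<in> I \<Longrightarrow> p \<in> I \<Longrightarrow> q \<in> I"
  using diff[of p "p - q"] by simp

lemma cong_mult:
  assumes "p - q \<in> I" "r - s \<in> I"
  shows "p * r - q * s \<in> I"
proof -
  have "p * r - q * s = (p - q) * r + q * (r - s)" by (simp add: algebra_simps)
  then show ?thesis using assms by (simp add: add mult mult_right)
qed

lemma cong_power: "p - q \<in> I \<Longrightarrow> p ^ n - q ^ n \<in> I"
  by (induction n) (auto intro: zero cong_mult)

end

locale radical_ideal = ideal +
  assumes rad: "p ^ n \<in> I \<Longrightarrow> p \<in> I"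

lemma (in ideal) radical_ideal_radical: "radical_ideal (radical I)"
proof
  show "0 \<in> radical I"
    unfolding radical_def using zero power_one_right by (auto intro: exI[of _ 1])
next
  fix p q assume "p \<in> radical I" "q \<in> radical I"
  then obtain m n where m: "p ^ m \<in> I" and n: "q ^ n \<in> I" by (auto simp: radical_def)
  \<comment> \<open>Each term of \<open>(p + q) ^ (m + n)\<close> contains \<open>p ^ m\<close> or
    \<open>q ^ n\<close>, since the two exponents add up to \<open>m + n\<close>.\<close>
  have "of_nat (m + n choose k) * p ^ k * q ^ (m + n - k) \<in> I" if "k \<le> m + n" for k
  proof (cases "k \<ge> m")
    case True
    then have "p ^ k = p ^ m * p ^ (k - m)" by (simp flip: power_add)
    then show ?thesis using m by (simp add: mult mult_right)
  next
    case False
    then have "q ^ (m + n - k) = q ^ n * q ^ (m - k)" by (simp add: add.commute flip: power_add)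
    then show ?thesis using n by (simp add: mult mult_right)
  qed
  then have "(p + q) ^ (m + n) \<in> I"
    unfolding binomial_ring by (intro sum) auto
  then show "p + q \<in> radical I" by (auto simp: radical_def)
next
  fix p r assume "p \<in> radical I"
  then show "r * p \<in> radical I" by (auto simp: radical_def power_mult_distrib intro: mult)
next
  fix p n assume "p ^ n \<in> radical I"
  then show "p \<in> radical I" by (auto simp: radical_def simp flip: power_mult)
qed

lemma (in ideal) subset_radical: "I \<subseteq> radical I"
  unfolding radical_def using power_one_right by (auto intro: exI[of _ 1])

text \<open>Passing to I + (x) restricts to the hyperplane section x = 0.\<close>

lemma (in ideal) ideal_sum_principal: "ideal {r + x * s | r s. r \<in> I}"
proof
  show "0 \<in> {r + x * s | r s. r \<in> I}"
    using zero by (auto intro!: exI[of _ 0])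
next
  fix p q assume "p \<in> {r + x * s | r s. r \<in> I}" "q \<in> {r + x * s | r s. r \<in> I}"
  then obtain r s r' s' where "p = r + x * s" "q = r' + x * s'" "r \<in> I" "r' \<in> I" by auto
  then have "p + q = (r + r') + x * (s + s') \<and> r + r' \<in> I"
    by (simp add: algebra_simps add)
  then show "p + q \<in> {r + x * s | r s. r \<in> I}" by blast
next
  fix p c assume "p \<in> {r + x * s | r s. r \<in> I}"
  then obtain r s where "p = r + x * s" "r \<in> I" by auto
  then have "c * p = c * r + x * (c * s) \<and> c * r \<in> I"
    by (simp add: algebra_simps mult)
  then show "c * p \<in> {r + x * s | r s. r \<in> I}" by blast
qed

lemma ideal_ideal_gen: "ideal (ideal_gen G)"
proof
  show "0 \<in> ideal_gen G"
    unfolding ideal_gen_def by (auto intro!: exI[of _ "{}"])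
next
  fix p q assume "p \<in> ideal_gen G" "q \<in> ideal_gen G"
  then obtain F r F' r' where F: "finite F" "F \<subseteq> G" "p = (\<Sum>g\<in>F. r g * g)"
    and F': "finite F'" "F' \<subseteq> G" "q = (\<Sum>g\<in>F'. r' g * g)" by (auto simp: ideal_gen_def)
  define s where "s g = (if g \<in> F then r g else 0) + (if g \<in> F' then r' g else 0)" for g
  have "(\<Sum>g\<in>F \<union> F'. (if g \<in> F then r g else 0) * g) = p"
    unfolding F(3) using F F' by (intro sum.mono_neutral_cong_right) auto
  moreover have "(\<Sum>g\<in>F \<union> F'. (if g \<in> F' then r' g else 0) * g) = q"
    unfolding F'(3) using F F' by (intro sum.mono_neutral_cong_right) auto
  ultimately have "p + q = (\<Sum>g\<in>F \<union> F'. s g * g)"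
    by (simp add: s_def distrib_right sum.distrib)
  then show "p + q \<in> ideal_gen G"
    using F F' unfolding ideal_gen_def by blast
next
  fix p c assume "p \<in> ideal_gen G"
  then obtain F r where F: "finite F" "F \<subseteq> G" "p = (\<Sum>g\<in>F. r g * g)"
    by (auto simp: ideal_gen_def)
  then have "c * p = (\<Sum>g\<in>F. (c * r g) * g)" by (simp add: sum_distrib_left mult.assoc)
  then show "c * p \<in> ideal_gen G"
    using F unfolding ideal_gen_def by (auto intro!: exI[of _ F] exI[of _ "\<lambda>g. c * r g"])
qed

lemma ideal_gen_superset: "G \<subseteq> ideal_gen G"
proof
  fix g assume "g \<in> G"
  then show "g \<in> ideal_gen G"
    unfolding ideal_gen_def by (auto intro!: exI[of _ "{g}"] exI[of _ "\<lambda>_. 1"])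
qed

lemma (in ideal) ideal_gen_subset: "G \<subseteq> I \<Longrightarrow> ideal_gen G \<subseteq> I"
  by (auto simp: ideal_gen_def intro!: sum mult)

lemma (in radical_ideal) radical_ideal_gen_subset: "G \<subseteq> I \<Longrightarrow> radical (ideal_gen G) \<subseteq> I"
  unfolding radical_def using ideal_gen_subset[of G] by (blast intro: rad)

lemma radical_ideal_gen:
  "radical_ideal (radical (ideal_gen G))" "G \<subseteq> radical (ideal_gen G)"
  using ideal.radical_ideal_radical[OF ideal_ideal_gen] ideal.subset_radical[OF ideal_ideal_gen]
    ideal_gen_superset by blast+

section \<open>Saturation with respect to one element\<close>

definition saturation :: "'r::comm_ring_1 set \<Rightarrow> 'r \<Rightarrow> 'r set" where
  "saturation I x = {p. \<exists>n. x ^ n * p \<in> I}"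

lemma saturationI: "x ^ n * p \<in> I \<Longrightarrow> p \<in> saturation I x"
  by (auto simp: saturation_def)

lemma saturation_cancel: "x ^ n * p \<in> saturation I x \<Longrightarrow> p \<in> saturation I x"
  by (auto simp: saturation_def simp flip: power_add mult.assoc)

lemma subset_saturation: "I \<subseteq> saturation I x"
  using saturationI[of x 0] by auto

lemma (in radical_ideal) radical_ideal_saturation: "radical_ideal (saturation I x)"
proof
  show "0 \<in> saturation I x" using subset_saturation zero by auto
next
  fix p q assume "p \<in> saturation I x" "q \<in> saturation I x"
  then obtain m n where "x ^ m * p \<in> I" "x ^ n * q \<in> I" by (auto simp: saturation_def)
  then have "x ^ n * (x ^ m * p) + x ^ m * (x ^ n * q) \<in> I" by (rule add[OF mult mult])
  then show "p + q \<in> saturation I x"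
    by (intro saturationI[of _ "m + n"]) (simp add: power_add algebra_simps)
next
  fix p c assume "p \<in> saturation I x"
  then obtain n where "x ^ n * p \<in> I" by (auto simp: saturation_def)
  then have "c * (x ^ n * p) \<in> I" by (rule mult)
  then show "c * p \<in> saturation I x"
    by (intro saturationI[of _ n]) (simp add: algebra_simps)
next
  fix p n assume "p ^ n \<in> saturation I x"
  then obtain m where m: "x ^ m * p ^ n \<in> I" by (auto simp: saturation_def)
  show "p \<in> saturation I x"
  proof (cases n)
    case 0
    then have "x ^ m * p \<in> I" using m by (simp add: mult_right)
    then show ?thesis by (rule saturationI)
  next
    case (Suc k)
    \<comment> \<open>Only one factor \<open>x ^ m\<close> is available, but raising x to a higher
      power is harmless, so \<open>x ^ m * p\<close> itself gets a power in
      \<open>I\<close>.\<close>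
    have "(x ^ m * p) ^ n = x ^ (m * k) * (x ^ m * p ^ n)"
      by (simp add: Suc power_mult_distrib power_add mult_ac flip: power_mult)
    then have "(x ^ m * p) ^ n \<in> I" using m by (simp add: mult)
    then have "x ^ m * p \<in> I" by (rule rad)
    then show ?thesis by (rule saturationI)
  qed
qed

text \<open>Algebraic form of a geometric splitting: a function vanishing on the zero set of
  \<open>I\<close> both where x is invertible and where x = 0 vanishes on all of it. Modulo
  \<open>I\<close>, \<open>p ^ n\<close> is a multiple of x, so a high power of it times
  \<open>p\<close> is killed by the saturation condition.\<close>

lemma (in radical_ideal) saturation_radical_sum_subset:
  assumes "p \<in> saturation I x" "p \<in> radical {r + x * s | r s. r \<in> I}"
  shows "p \<in> I"
proof -
  obtain m where m: "x ^ m * p \<in> I" using assms(1) by (auto simp: saturation_def)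
  obtain n r s where n: "p ^ n = r + x * s" and r: "r \<in> I"
    using assms(2) by (auto simp: radical_def)
  have "p ^ n - x * s \<in> I" using n r by simp
  then have "(p ^ n) ^ m - (x * s) ^ m \<in> I" by (rule cong_power)
  then have "(p ^ n) ^ m * p - (x * s) ^ m * p \<in> I" by (intro cong_mult cong_refl)
  moreover have "(x * s) ^ m * p = s ^ m * (x ^ m * p)" by (simp add: power_mult_distrib mult_ac)
  then have "(x * s) ^ m * p \<in> I" using m by (simp add: mult)
  ultimately have "(p ^ n) ^ m * p \<in> I" by (metis cong_sym cong_mem)
  moreover have "(p ^ n) ^ m * p = p ^ Suc (n * m)" by (simp add: mult.commute flip: power_mult)
  ultimately show ?thesis using rad by metis
qed

section \<open>Congruences between monomials\<close>

text \<open>\<open>X\<close> is any assignment of ring elements to the variables, so the congruences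
  below live in an arbitrary commutative ring; the indeterminates are substituted only at the
  end.\<close>

definition mon :: "(var \<Rightarrow> 'r::comm_ring_1) \<Rightarrow> (var \<Rightarrow> nat) \<Rightarrow> 'r" where
  "mon X e = X X1 ^ e X1 * X X2 ^ e X2 * X X3 ^ e X3 * X X4 ^ e X4"

text \<open>Exponents of \<open>s\<close> and of \<open>t\<close> under \<open>(x, y, z, w) = (s, s t^2, s^2 t^3, s^2 t^5)\<close>.\<close>

definition degs :: "(var \<Rightarrow> nat) \<Rightarrow> nat" where
  "degs e = e X1 + e X2 + 2 * e X3 + 2 * e X4"

definition degt :: "(var \<Rightarrow> nat) \<Rightarrow> nat" where
  "degt e = 2 * e X2 + 3 * e X3 + 5 * e X4"

lemma mon_add: "mon X (\<lambda>v. e v + e' v) = mon X e * mon X e'"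
  by (simp add: mon_def power_add mult_ac)

lemma mon_scale: "mon X (\<lambda>v. n * e v) = mon X e ^ n"
  by (simp add: mon_def power_mult_distrib mult.commute flip: power_mult)

lemma mon_X1: "mon X (\<lambda>v. if v = X1 then n else 0) = X X1 ^ n"
  by (simp add: mon_def)

text \<open>The bidegrees (1,0), (1,2), (2,3), (2,5) span a cone with extremal rays (1,0) and (2,5),
  which gives the inequality. Use (2,5) as often as possible, fill up the residue of
  \<open>B\<close> mod 5 by (1,2) and (2,3), and the rest of \<open>A\<close> by (1,0).\<close>

lemma exists_exponents:
  assumes "5 * A \<ge> 2 * B" "B \<noteq> 1"
  shows "\<exists>e. degs e = A \<and> degt e = B"
proof -
  have wit: ?thesis if "A = i + j + 2 * k + 2 * l" "B = 2 * j + 3 * k + 5 * l" for i j k l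
    using that by (intro exI[of _ "row4 i j k l"]) (simp add: degs_def degt_def row4_def)
  define q where "q = B div 5"
  have B: "B = 5 * q + B mod 5" by (simp add: q_def)
  have "B mod 5 < 5" by simp
  then consider "B mod 5 = 0" | "B mod 5 = 1" | "B mod 5 = 2" | "B mod 5 = 3" | "B mod 5 = 4"
    by linarith
  then show ?thesis
  proof cases
    case 1
    then show ?thesis using B assms by (intro wit[of "A - 2 * q" 0 0 q]) linarith+
  next
    case 2
    \<comment> \<open>Residue 1 is not a sum of 2s and 3s: one copy of 5 is given back and 6 = 2 + 2
      + 2 is used. This needs \<open>B\<close> at least 6.\<close>
    then have "q > 0" using B assms by (cases q) auto
    then show ?thesis using 2 B assms by (intro wit[of "A - (2 * q + 1)" 3 0 "q - 1"]) linarith+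
  next
    case 3
    then show ?thesis using B assms by (intro wit[of "A - (2 * q + 1)" 1 0 q]) linarith+
  next
    case 4
    then show ?thesis using B assms by (intro wit[of "A - (2 * q + 2)" 0 1 q]) linarith+
  next
    case 5
    then show ?thesis using B assms by (intro wit[of "A - (2 * q + 2)" 2 0 q]) linarith+
  qed
qed

section \<open>Monomials on the toric surface\<close>

context ideal
begin

lemma mon_mem:
  assumes "X v \<in> I" "e v > 0"
  shows "mon X e \<in> I"
  using assms by (cases v) (auto simp: mon_def intro: mult mult_right power)

text \<open>Equal t-degrees force \<open>k - k'\<close> to be even, so the surplus of z can be
  removed by replacing z^2 with x y^3, which has the same bidegree.\<close>

lemma surface_cong_xyz:
  assumes "x * y ^ 3 - z ^ 2 \<in> I"
    and "i + j + 2 * k = i' + j' + 2 * k'" "2 * j + 3 * k = 2 * j' + 3 * k'" "k' \<le> k"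
  shows "x ^ i * y ^ j * z ^ k - x ^ i' * y ^ j' * z ^ k' \<in> I"
proof -
  have "even (k - k')" using assms(3,4) by presburger
  then obtain n where n: "k - k' = 2 * n" by (elim evenE)
  then have k: "k = 2 * n + k'" using assms(4) by linarith
  have k': "j' = j + 3 * n" using assms(3) k by linarith
  have k'': "i' = i + n" using assms(2) k k' by linarith
  have "(z ^ 2) ^ n - (x * y ^ 3) ^ n \<in> I" by (rule cong_power[OF cong_sym[OF assms(1)]])
  then have "x ^ i * y ^ j * z ^ k' * (z ^ 2) ^ n - x ^ i * y ^ j * z ^ k' * (x * y ^ 3) ^ n \<in> I"
    by (intro cong_mult cong_refl)
  moreover have "x ^ i * y ^ j * z ^ k' * (z ^ 2) ^ n = x ^ i * y ^ j * z ^ k"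
    by (simp add: k power_add mult_ac flip: power_mult)
  moreover have "x ^ i * y ^ j * z ^ k' * (x * y ^ 3) ^ n = x ^ i' * y ^ j' * z ^ k'"
    by (simp add: k' k'' power_add power_mult_distrib mult_ac flip: power_mult)
  ultimately show ?thesis by simp
qed

text \<open>After multiplication by a power of x, every w can be traded for y z / x, which reduces
  to monomials in x, y, z. The hypothesis \<open>cancel\<close> then removes the power of x; it is
  supplied by saturation.\<close>

lemma surface_cong:
  assumes "X X1 * X X4 - X X2 * X X3 \<in> I" "X X1 * X X2 ^ 3 - X X3 ^ 2 \<in> I"
    and cancel: "\<And>n p. X X1 ^ n * p \<in> I \<Longrightarrow> p \<in> I"
    and "degs e = degs e'" "degt e = degt e'"
  shows "mon X e - mon X e' \<in> I"
proof -
  let ?x = "X X1" and ?y = "X X2" and ?z = "X X3" and ?w = "X X4"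
  \<comment> \<open>The spare exponent \<open>n\<close> lets both monomials be multiplied by the
    same power of x.\<close>
  have elim: "?x ^ (e X4 + n) * mon X e
      - ?x ^ (e X1 + n) * ?y ^ (e X2 + e X4) * ?z ^ (e X3 + e X4) \<in> I" for e n
  proof -
    have "(?x * ?w) ^ e X4 - (?y * ?z) ^ e X4 \<in> I" using assms(1) by (rule cong_power)
    then have "?x ^ (e X1 + n) * ?y ^ e X2 * ?z ^ e X3 * (?x * ?w) ^ e X4
        - ?x ^ (e X1 + n) * ?y ^ e X2 * ?z ^ e X3 * (?y * ?z) ^ e X4 \<in> I"
      by (intro cong_mult cong_refl)
    then show ?thesis by (simp add: mon_def power_add power_mult_distrib mult_ac)
  qed
  have "?x ^ (e X1 + e' X4) * ?y ^ (e X2 + e X4) * ?z ^ (e X3 + e X4)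
      - ?x ^ (e' X1 + e X4) * ?y ^ (e' X2 + e' X4) * ?z ^ (e' X3 + e' X4) \<in> I"
  proof (cases "e' X3 + e' X4 \<le> e X3 + e X4")
    case True
    then show ?thesis
      using assms by (intro surface_cong_xyz) (auto simp: degs_def degt_def)
  next
    case False
    then show ?thesis
      using assms by (intro cong_sym[OF surface_cong_xyz]) (auto simp: degs_def degt_def)
  qed
  then have "?x ^ (e X4 + e' X4) * mon X e - ?x ^ (e' X4 + e X4) * mon X e' \<in> I"
    using cong_trans cong_sym elim by meson
  then have "?x ^ (e X4 + e' X4) * (mon X e - mon X e') \<in> I"
    by (simp add: algebra_simps)
  then show ?thesis by (rule cancel)
qed

end

section \<open>The third equation and the curve on the surface\<close>

definition curve_poly :: "(var \<Rightarrow> 'r::comm_ring_1) \<Rightarrow> (nat \<Rightarrow> var \<Rightarrow> nat) \<Rightarrow> 'r" where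
  "curve_poly X e = (\<Sum>i\<le>5. of_nat (5 choose i) * (- 1) ^ i * mon X (e i))"

text \<open>The exponent 5 makes the last monomial lie in bidegree (2 a, 5 a), on the extremal ray
  of w, while the factor x^(3 a) lifts each monomial to the matching term of the binomial expansion:
  both have bidegree (5 a + (5 - i) b, i a). Radicality removes the fifth power.\<close>

lemma (in radical_ideal) curve_cong:
  assumes minors: "X X1 * X X4 - X X2 * X X3 \<in> I" "X X1 * X X2 ^ 3 - X X3 ^ 2 \<in> I"
    and cancel: "\<And>n p. X X1 ^ n * p \<in> I \<Longrightarrow> p \<in> I"
    and curve: "curve_poly X e \<in> I"
    and e: "\<And>i. i \<le> 5 \<Longrightarrow> degs (e i) = 2 * a + (5 - i) * b" "\<And>i. i \<le> 5 \<Longrightarrow> degt (e i) = i * a"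
    and q: "degs q = a" "degt q = a"
  shows "X X1 ^ (a + b) - mon X q \<in> I"
proof -
  let ?x = "X X1"
  have "?x ^ (3 * a) * mon X (e i) - (?x ^ (a + b)) ^ (5 - i) * mon X q ^ i \<in> I" if i: "i \<le> 5" for i
  proof -
    let ?e = "\<lambda>v. (if v = X1 then 3 * a else 0) + e i v"
    let ?e' = "\<lambda>v. (if v = X1 then (a + b) * (5 - i) else 0) + i * q v"
    obtain j where j: "5 = i + j" using le_Suc_ex[OF i] by blast
    then have ji: "5 - i = j" by simp
    have "degs ?e = 3 * a + degs (e i)" "degs ?e' = (a + b) * (5 - i) + i * degs q"
      by (simp_all add: degs_def distrib_left mult.left_commute)
    moreover have "5 * a = i * a + j * a" unfolding j by (rule distrib_right)
    ultimately have "degs ?e = degs ?e'"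
      unfolding e(1)[OF i] q ji by (simp add: algebra_simps)
    moreover have "degt ?e = degt (e i)" "degt ?e' = i * degt q"
      by (simp_all add: degt_def distrib_left mult.left_commute)
    ultimately have deg: "degs ?e = degs ?e'" "degt ?e = degt ?e'"
      using e(2)[OF i] q by simp_all
    have "mon X ?e - mon X ?e' \<in> I"
      by (intro surface_cong[OF minors] deg) (rule cancel)
    then show ?thesis unfolding mon_add mon_scale mon_X1 power_mult .
  qed
  then have "(\<Sum>i\<le>5. of_nat (5 choose i) * (- 1) ^ i *
      (?x ^ (3 * a) * mon X (e i) - (?x ^ (a + b)) ^ (5 - i) * mon X q ^ i)) \<in> I"
    by (intro sum mult) auto
  moreover have "(?x ^ (a + b) - mon X q) ^ 5 =
      (\<Sum>i\<le>5. of_nat (5 choose i) * (- 1) ^ i * ((?x ^ (a + b)) ^ (5 - i) * mon X q ^ i))"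
    using binomial_ring[of "- mon X q" "?x ^ (a + b)" 5]
    by (simp add: power_minus[of "mon X q"] mult_ac)
  moreover have "?x ^ (3 * a) * curve_poly X e =
      (\<Sum>i\<le>5. of_nat (5 choose i) * (- 1) ^ i * (?x ^ (3 * a) * mon X (e i)))"
    by (simp add: curve_poly_def sum_distrib_left mult_ac)
  ultimately have "?x ^ (3 * a) * curve_poly X e - (?x ^ (a + b) - mon X q) ^ 5 \<in> I"
    by (simp add: right_diff_distrib sum_subtractf)
  then have "(?x ^ (a + b) - mon X q) ^ 5 \<in> I"
    using curve by (blast intro: cong_mem mult)
  then show ?thesis by (rule rad)
qed

text \<open>The quotient of x^(a + b) by \<open>mon X q\<close> has bidegree (b, -a). As
  \<open>a\<close> and \<open>b\<close> are coprime, this generates all differences of bidegrees of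
  equal weight, so some power \<open>k\<close> of the relation carries one monomial to the
  other.\<close>

lemma (in ideal) binomial_cong:
  assumes minors: "X X1 * X X4 - X X2 * X X3 \<in> I" "X X1 * X X2 ^ 3 - X X3 ^ 2 \<in> I"
    and cancel: "\<And>n p. X X1 ^ n * p \<in> I \<Longrightarrow> p \<in> I"
    and q: "degs q = a" "degt q = a" "X X1 ^ (a + b) - mon X q \<in> I"
    and ab: "coprime a b" "a > 0" "b > 0"
    and weight: "a * degs u + b * degt u = a * degs v + b * degt v" and le: "degt u \<le> degt v"
  shows "mon X u - mon X v \<in> I"
proof -
  let ?x = "X X1"
  have "b * degt u \<le> b * degt v" using le by simp
  then have "a * degs v \<le> a * degs u" using weight by linarith
  then have "degs v \<le> degs u" using ab by simp
  then have *: "a * (degs u - degs v) = b * (degt v - degt u)"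
    using weight le by (simp add: diff_mult_distrib2)
  then have "a dvd degt v - degt u"
    using ab by (metis coprime_dvd_mult_right_iff dvd_triv_left)
  then obtain k where k: "degt v - degt u = a * k" by blast
  then have k': "degs u - degs v = b * k" using * ab by simp
  \<comment> \<open>Denominators are avoided by padding \<open>u\<close> with q^k and
    \<open>v\<close> with x^((a + b) k); the padded monomials agree in bidegree.\<close>
  let ?u = "\<lambda>i. u i + k * q i" and ?v = "\<lambda>i. (if i = X1 then (a + b) * k else 0) + v i"
  have "degs ?u = degs u + k * degs q" "degt ?u = degt u + k * degt q"
    "degs ?v = (a + b) * k + degs v" "degt ?v = degt v"
    by (simp_all add: degs_def degt_def algebra_simps)
  then have deg: "degs ?u = degs ?v" "degt ?u = degt ?v"
    using k k' \<open>degs v \<le> degs u\<close> le q by (auto simp: algebra_simps)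
  have "mon X ?u - mon X ?v \<in> I"
    by (intro surface_cong[OF minors] deg) (rule cancel)
  then have "mon X u * mon X q ^ k - (?x ^ (a + b)) ^ k * mon X v \<in> I"
    unfolding mon_add mon_scale mon_X1 power_mult .
  moreover have "mon X u * (?x ^ (a + b)) ^ k - mon X u * mon X q ^ k \<in> I"
    using q by (intro cong_mult cong_refl cong_power)
  ultimately have "mon X u * (?x ^ (a + b)) ^ k - (?x ^ (a + b)) ^ k * mon X v \<in> I"
    by (rule cong_trans[rotated])
  then have "?x ^ ((a + b) * k) * (mon X u - mon X v) \<in> I"
    unfolding power_mult by (simp only: right_diff_distrib left_diff_distrib mult.commute)
  then show ?thesis by (rule cancel)
qed

text \<open>The difference is shown to lie in the saturation \<open>S\<close>, where x can be
  cancelled, and in the radical \<open>Q\<close> of I + (x), where all four variables vanish;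
  together these give membership in \<open>I\<close>.\<close>

lemma (in radical_ideal) binomial_mem:
  assumes f: "X X1 * X X2 ^ 3 - X X3 ^ 2 \<in> I"
    and g: "X X2 ^ 5 - 2 * X X2 * X X3 * X X4 + X X1 * X X4 ^ 2 \<in> I"
    and h: "curve_poly X e \<in> I"
    and e: "\<And>i. i \<le> 5 \<Longrightarrow> degs (e i) = 2 * a + (5 - i) * b" "\<And>i. i \<le> 5 \<Longrightarrow> degt (e i) = i * a"
    and ab: "coprime a b" "a \<ge> 2" "b > 0"
    and weight: "a * degs u + b * degt u = a * degs v + b * degt v"
  shows "mon X u - mon X v \<in> I"
proof -
  let ?x = "X X1" and ?y = "X X2" and ?z = "X X3" and ?w = "X X4"
  text \<open>The 2-minors of the matrix with rows \<open>(x, z, y)\<close> and \<open>(z, y^3, w)\<close> cut out the surface.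
    Its left block is symmetric with determinant \<open>f\<close>, and \<open>g\<close> is the value of the adjugate
    quadratic form on the last column, which is a square up to a factor when \<open>f = 0\<close>.\<close>
  have "(?x * ?w - ?y * ?z) ^ 2 = ?x * (?y ^ 5 - 2 * ?y * ?z * ?w + ?x * ?w ^ 2)
      - ?y ^ 2 * (?x * ?y ^ 3 - ?z ^ 2)"
    by (simp add: algebra_simps power2_eq_square numeral_eq_Suc)
  then have "(?x * ?w - ?y * ?z) ^ 2 \<in> I"
    using f g by (simp add: diff mult)
  then have minor: "?x * ?w - ?y * ?z \<in> I" by (rule rad)

  define S where "S = saturation I ?x"
  interpret S: radical_ideal S unfolding S_def by (rule radical_ideal_saturation)
  have IS: "I \<subseteq> S" unfolding S_def by (rule subset_saturation)
  have cancel: "p \<in> S" if "?x ^ n * p \<in> S" for n p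
    using that unfolding S_def by (rule saturation_cancel)
  \<comment> \<open>The gap of the semigroup is avoided because \<open>a\<close> is not 1.\<close>
  obtain q where q: "degs q = a" "degt q = a" using exists_exponents[of a a] ab by auto
  have minors: "?x * ?w - ?y * ?z \<in> S" "?x * ?y ^ 3 - ?z ^ 2 \<in> S" using f minor IS by auto
  have "?x ^ (a + b) - mon X q \<in> S"
    using IS h by (intro S.curve_cong[OF minors cancel _ e q]) auto
  note cong = S.binomial_cong[OF minors cancel q this \<open>coprime a b\<close> _ \<open>b > 0\<close>]
  have S: "mon X u - mon X v \<in> S"
  proof (cases "degt u \<le> degt v")
    case True
    then show ?thesis using cong weight ab by simp
  next
    case False
    then have "mon X v - mon X u \<in> S" using cong weight ab by simp
    then show ?thesis by (rule S.cong_sym)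
  qed

  define Q where "Q = radical {r + ?x * s | r s. r \<in> I}"
  interpret P: ideal "{r + ?x * s | r s. r \<in> I}" by (rule ideal_sum_principal)
  interpret Q: radical_ideal Q unfolding Q_def by (rule P.radical_ideal_radical)
  have IQ: "r + ?x * s \<in> Q" if "r \<in> I" for r s
    using P.subset_radical that unfolding Q_def by blast
  have x: "?x \<in> Q" using IQ[of 0 1] zero by simp
  have "?z ^ 2 \<in> Q" using IQ[OF minus[OF f], of "?y ^ 3"] by simp
  then have z: "?z \<in> Q" by (rule Q.rad)
  have "?y ^ 5 = (?y ^ 5 - 2 * ?y * ?z * ?w + ?x * ?w ^ 2 + ?x * (- (?w ^ 2))) + 2 * ?y * ?w * ?z"
    by (simp add: algebra_simps)
  also have "\<dots> \<in> Q" by (rule Q.add[OF IQ[OF g] Q.mult[OF z]])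
  finally have y: "?y \<in> Q" by (rule Q.rad)
  have "mon X (e i) \<in> Q" if "i < 5" for i
  proof -
    \<comment> \<open>The inequality is strict off the extremal ray of w, so the monomial involves
      x, y or z and vanishes on x = 0.\<close>
    have "2 * degt (e i) < 5 * degs (e i)"
    proof -
      have "2 * (i * a) < 10 * a" using that ab by simp
      then have "2 * (i * a) < 5 * (2 * a + (5 - i) * b)"
        unfolding distrib_left by (intro trans_less_add1) simp
      then show ?thesis using e[of i] that by simp
    qed
    then have "e i X1 > 0 \<or> e i X2 > 0 \<or> e i X3 > 0" by (auto simp: degs_def degt_def)
    then show ?thesis using x y z Q.mon_mem by blast
  qed
  then have "(\<Sum>i<5. of_nat (5 choose i) * (- 1) ^ i * mon X (e i)) \<in> Q"
    by (intro Q.sum Q.mult) auto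
  moreover have "curve_poly X e \<in> Q" using IQ[OF h, of 0] by simp
  moreover have "{..5::nat} = insert 5 {..<5}" by auto
  then have "curve_poly X e = (\<Sum>i<5. of_nat (5 choose i) * (- 1) ^ i * mon X (e i)) - mon X (e 5)"
    by (simp add: curve_poly_def)
  ultimately have "mon X (e 5) \<in> Q" using Q.diff by fastforce
  \<comment> \<open>Here 5 \<open>degs\<close> = 2 \<open>degt\<close>, and 5 \<open>degs\<close> -
    2 \<open>degt\<close> equals 5 \<open>e 5 X1\<close> + \<open>e 5 X2\<close> + 4
    \<open>e 5 X3\<close>, so these exponents vanish.\<close>
  moreover have "e 5 X1 = 0" "e 5 X2 = 0" "e 5 X3 = 0"
    using e[of 5] by (auto simp: degs_def degt_def)
  then have "mon X (e 5) = ?w ^ e 5 X4" by (simp add: mon_def)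
  ultimately have w: "?w \<in> Q" using Q.rad by metis
  have mon_Q: "mon X u \<in> Q" if "u i > 0" for u i
    using Q.mon_mem[of X i u] x y z w that by (cases i) auto
  show ?thesis
  \<comment> \<open>The constant monomial need not lie in \<open>Q\<close>; but since all weights
    are positive, if one monomial is constant, so is the other.\<close>
  proof (cases "degs u = 0 \<or> degs v = 0")
    case True
    then have "degs u = 0 \<and> degs v = 0"
      using weight ab by (auto simp: degs_def degt_def)
    then have "mon X u = mon X v" by (auto simp: degs_def mon_def)
    then show ?thesis by (simp add: zero)
  next
    case False
    then have "(\<exists>i. u i > 0) \<and> (\<exists>i. v i > 0)" by (fastforce simp: degs_def)
    then have "mon X u - mon X v \<in> Q" using mon_Q by (blast intro: Q.diff)
    then show ?thesis using S unfolding S_def Q_def by (rule saturation_radical_sum_subset[rotated])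
  qed
qed

text \<open>Substituting the powers of x for y, z, w turns each monomial into x to its
  weight.\<close>

lemma (in ideal) binomial_mem_1:
  assumes "X X2 - X X1 ^ (1 + 2 * b) \<in> I" "X X3 - X X1 ^ (2 + 3 * b) \<in> I"
    "X X4 - X X1 ^ (2 + 5 * b) \<in> I"
    and weight: "degs u + b * degt u = degs v + b * degt v"
  shows "mon X u - mon X v \<in> I"
proof -
  let ?x = "X X1"
  have "mon X u - ?x ^ (degs u + b * degt u) \<in> I" for u
  proof -
    have "mon X u - ?x ^ u X1 * (?x ^ (1 + 2 * b)) ^ u X2 * (?x ^ (2 + 3 * b)) ^ u X3
        * (?x ^ (2 + 5 * b)) ^ u X4 \<in> I"
      unfolding mon_def using assms by (intro cong_mult cong_power cong_refl)
    moreover have "?x ^ u X1 * (?x ^ (1 + 2 * b)) ^ u X2 * (?x ^ (2 + 3 * b)) ^ u X3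
        * (?x ^ (2 + 5 * b)) ^ u X4 = ?x ^ (degs u + b * degt u)"
      unfolding power_mult[symmetric] power_add[symmetric]
      by (rule arg_cong[of _ _ "\<lambda>n. ?x ^ n"]) (simp add: degs_def degt_def algebra_simps)
    ultimately show ?thesis by simp
  qed
  from this[of u] this[of v] show ?thesis using weight cong_trans cong_sym by metis
qed

section \<open>The toric ideal\<close>

lemma poly_mapping_sum_single:
  "p = (\<Sum>m\<in>Poly_Mapping.keys p. Poly_Mapping.single m (Poly_Mapping.lookup p m))"
  by (rule poly_mapping_eqI)
    (auto simp: lookup_sum lookup_single when_def in_keys_iff)

section \<open>The toric map as a ring homomorphism\<close>

lemma toric_map_superset:
  assumes "finite A" "Poly_Mapping.keys p \<subseteq> A"
  shows "toric_map w p = (\<Sum>m\<in>A. monom (Poly_Mapping.lookup p m) (wdeg w m))"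
  unfolding toric_map_def using assms
  by (intro sum.mono_neutral_left) (auto simp: in_keys_iff)

lemma toric_map_add: "toric_map w (p + q) = toric_map w p + toric_map w q"
proof -
  let ?A = "Poly_Mapping.keys p \<union> Poly_Mapping.keys q"
  have "toric_map w r = (\<Sum>m\<in>?A. monom (Poly_Mapping.lookup r m) (wdeg w m))"
    if "r \<in> {p, q, p + q}" for r
    using that Poly_Mapping.keys_add[of p q] by (intro toric_map_superset) auto
  then show ?thesis by (simp add: lookup_add add_monom[symmetric] sum.distrib)
qed

lemma toric_map_single: "toric_map w (Poly_Mapping.single m c) = monom c (wdeg w m)"
  by (cases "c = 0") (simp_all add: toric_map_def)

lemma toric_map_0: "toric_map w 0 = 0"
  by (simp add: toric_map_def)

lemma toric_map_sum: "toric_map w (sum f A) = (\<Sum>i\<in>A. toric_map w (f i))"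
  by (induction A rule: infinite_finite_induct) (simp_all add: toric_map_0 toric_map_add)

lemma toric_map_diff: "toric_map w (p - q) = toric_map w p - toric_map w q"
  using toric_map_add[of w "p - q" q] by simp

lemma wdeg_add: "wdeg w (m + m') = wdeg w m + wdeg w m'"
  by (simp add: wdeg_def lookup_add algebra_simps)

lemma toric_map_mult: "toric_map w (p * q) = toric_map w p * toric_map w q"
proof -
  let ?s = "\<lambda>p m. Poly_Mapping.single m (Poly_Mapping.lookup p m)"
  have "p * q = (\<Sum>m\<in>Poly_Mapping.keys p. ?s p m) * (\<Sum>n\<in>Poly_Mapping.keys q. ?s q n)"
    by (simp flip: poly_mapping_sum_single)
  also have "toric_map w \<dots> = toric_map w p * toric_map w q"
    by (simp add: sum_product toric_map_sum mult_single toric_map_single wdeg_add mult_monom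
        toric_map_def[of w p] toric_map_def[of w q])
  finally show ?thesis .
qed

lemma toric_map_1: "toric_map w 1 = 1"
  unfolding single_one[symmetric] toric_map_single by (simp add: wdeg_def)

lemma toric_map_power: "toric_map w (p ^ n) = toric_map w p ^ n"
  by (induction n) (simp_all add: toric_map_1 toric_map_mult)

lemma toric_map_of_nat: "toric_map w (of_nat n) = of_nat n"
  by (induction n) (simp_all add: toric_map_0 toric_map_1 toric_map_add)

lemma toric_map_uminus: "toric_map w (- p) = - toric_map w p"
  using toric_map_diff[of w 0 p] by (simp add: toric_map_0)

text \<open>It is the kernel of a ring homomorphism into the domain K[t].\<close>

lemma radical_ideal_toric_ideal: "radical_ideal (toric_ideal w :: 'a::field mpoly4 set)"
  by standard
    (simp_all add: toric_ideal_def toric_map_0 toric_map_add toric_map_mult toric_map_power)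

definition indet :: "var \<Rightarrow> 'a::comm_ring_1 mpoly4" where
  "indet v = Poly_Mapping.single (Poly_Mapping.single v 1) 1"

lemma toric_map_indet: "toric_map w (indet v) = monom 1 (w v)"
  by (cases v) (simp_all add: indet_def toric_map_single wdeg_def lookup_single)

lemma toric_map_mon:
  "toric_map w (mon indet e) = monom 1 (w X1 * e X1 + w X2 * e X2 + w X3 * e X3 + w X4 * e X4)"
  by (simp add: mon_def toric_map_mult toric_map_power toric_map_indet monom_power mult_monom)

lemma indet_power: "indet v ^ n = Poly_Mapping.single (Poly_Mapping.single v n) 1"
  by (induction n) (simp_all add: indet_def mult_single flip: single_add)

lemma single_eq_mon: "Poly_Mapping.single m 1 = mon indet (Poly_Mapping.lookup m)"
proof -
  let ?s = "\<lambda>v. Poly_Mapping.single v (Poly_Mapping.lookup m v)"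
  have "m = ?s X1 + ?s X2 + ?s X3 + ?s X4"
  proof (rule poly_mapping_eqI)
    fix v show "Poly_Mapping.lookup m v = Poly_Mapping.lookup (?s X1 + ?s X2 + ?s X3 + ?s X4) v"
      by (cases v) (simp_all add: lookup_add lookup_single)
  qed
  then show ?thesis
    unfolding mon_def indet_power mult_single by simp
qed

text \<open>Differences of monomials of equal weight span the toric ideal: replacing each monomial
  of \<open>p\<close> by a fixed representative of its weight changes \<open>p\<close> by such
  differences, and leaves 0.\<close>

lemma toric_ideal_subset:
  fixes J :: "'a::comm_ring_1 mpoly4 set"
  assumes "ideal J"
    and binomials: "\<And>m m'. wdeg w m = wdeg w m'
      \<Longrightarrow> Poly_Mapping.single m 1 - Poly_Mapping.single m' 1 \<in> J"
  shows "toric_ideal w \<subseteq> J"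
proof
  interpret ideal J by fact
  fix p :: "'a mpoly4" assume "p \<in> toric_ideal w"
  then have p: "toric_map w p = 0" by (simp add: toric_ideal_def)
  let ?K = "Poly_Mapping.keys p" and ?c = "Poly_Mapping.lookup p"
  define rep where "rep d = (SOME m. wdeg w m = d)" for d
  have rep: "wdeg w (rep (wdeg w m)) = wdeg w m" for m
    unfolding rep_def by (rule someI) (rule refl)
  have "(\<Sum>m\<in>?K. Poly_Mapping.single m (?c m) - Poly_Mapping.single (rep (wdeg w m)) (?c m)) \<in> J"
  proof (rule sum)
    fix m
    have "Poly_Mapping.single 0 (?c m) *
        (Poly_Mapping.single m 1 - Poly_Mapping.single (rep (wdeg w m)) 1) \<in> J"
      using rep by (intro mult binomials) simp
    then show "Poly_Mapping.single m (?c m) - Poly_Mapping.single (rep (wdeg w m)) (?c m) \<in> J"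
      by (simp add: right_diff_distrib mult_single)
  qed
  moreover have "(\<Sum>m\<in>?K. Poly_Mapping.single (rep (wdeg w m)) (?c m)) = 0"
  proof -
    \<comment> \<open>Within one weight class all representatives coincide, and the coefficients add
      up to the coefficient of t^d in the image of \<open>p\<close>.\<close>
    have "(\<Sum>m\<in>{m\<in>?K. wdeg w m = d}. Poly_Mapping.single (rep (wdeg w m)) (?c m)) = 0" for d
    proof -
      have "coeff (toric_map w p) d = (\<Sum>m\<in>?K. if wdeg w m = d then ?c m else 0)"
        by (simp add: toric_map_def coeff_sum)
      then have "(\<Sum>m\<in>{m\<in>?K. wdeg w m = d}. ?c m) = 0"
        using p by (simp add: sum.inter_filter)
      moreover have "(\<Sum>m\<in>A. Poly_Mapping.single k (?c m)) = Poly_Mapping.single k (\<Sum>m\<in>A. ?c m)"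
        for A and k :: "var \<Rightarrow>\<^sub>0 nat"
        by (induction A rule: infinite_finite_induct) (simp_all add: single_add)
      ultimately show ?thesis by simp
    qed
    then show ?thesis
      by (subst sum.image_gen[where g = "wdeg w"]) simp_all
  qed
  ultimately show "p \<in> J"
    by (simp add: sum_subtractf flip: poly_mapping_sum_single)
qed

text \<open>The values a = 4, b = 1 give the curve (t^4, t^6, t^11, t^13).\<close>

theorem theorem6p2:
  fixes a b :: nat
  assumes "a > 0" and "b > 0"
  shows "stci3 (toric_ideal (row4 a (a + 2*b) (2*a + 3*b) (2*a + 5*b)) :: 'a::field mpoly4 set)"
proof -
  let ?w = "row4 a (a + 2*b) (2*a + 3*b) (2*a + 5*b)"
  let ?I = "toric_ideal ?w :: 'a mpoly4 set"
  let ?x = "indet X1 :: 'a mpoly4" and ?y = "indet X2 :: 'a mpoly4"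
  let ?z = "indet X3 :: 'a mpoly4" and ?w4 = "indet X4 :: 'a mpoly4"
  define g where "g = gcd a b"
  have g: "g > 0" using assms by (simp add: g_def)
  obtain a' b' where a: "a = g * a'" and b: "b = g * b'" and cop: "coprime a' b'"
    using g gcd_coprime_exists[of a b] unfolding g_def by (metis mult.commute not_gr_zero)
  have a': "a' > 0" and b': "b' > 0" using assms a b by auto
  \<comment> \<open>The weight factors through the bidegree, since the curve lies on the surface;
    the common factor \<open>g\<close> does not affect which weights agree.\<close>
  have wdeg: "wdeg ?w m =
      g * (a' * degs (Poly_Mapping.lookup m) + b' * degt (Poly_Mapping.lookup m))" for m
    by (simp add: wdeg_def row4_def degs_def degt_def a b algebra_simps)
  have mon: "toric_map ?w (mon indet e :: 'a mpoly4) =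
      monom 1 (g * (a' * degs e + b' * degt e))" for e
    unfolding toric_map_mon
    by (rule arg_cong[of _ _ "monom 1"]) (simp add: row4_def degs_def degt_def a b algebra_simps)
  have stci: "stci3 ?I" if "{g1, g2, g3} \<subseteq> ?I"
    "\<And>u v. a' * degs u + b' * degt u = a' * degs v + b' * degt v \<Longrightarrow>
      mon indet u - mon indet v \<in> radical (ideal_gen {g1, g2, g3})" for g1 g2 g3
  proof -
    have "?I = radical (ideal_gen {g1, g2, g3})"
    proof
      interpret radical_ideal "radical (ideal_gen {g1, g2, g3})" by (rule radical_ideal_gen)
      show "?I \<subseteq> radical (ideal_gen {g1, g2, g3})"
        using g by (intro toric_ideal_subset ideal_axioms) (simp add: single_eq_mon wdeg that(2))
      show "radical (ideal_gen {g1, g2, g3}) \<subseteq> ?I"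
        using that(1) by (rule radical_ideal.radical_ideal_gen_subset[OF radical_ideal_toric_ideal])
    qed
    then show ?thesis unfolding stci3_def by blast
  qed
  show ?thesis
  proof (cases "a' = 1")
    case True
    show ?thesis
    proof (rule stci)
      let ?G = "{?y - ?x ^ (1 + 2 * b'), ?z - ?x ^ (2 + 3 * b'), ?w4 - ?x ^ (2 + 5 * b')}"
      show "?G \<subseteq> ?I"
        by (simp add: toric_ideal_def toric_map_diff toric_map_power toric_map_mult toric_map_indet
            monom_power mult_monom row4_def a b True algebra_simps)
      interpret radical_ideal "radical (ideal_gen ?G)" by (rule radical_ideal_gen)
      fix u v assume "a' * degs u + b' * degt u = a' * degs v + b' * degt v"
      then show "mon indet u - mon indet v \<in> radical (ideal_gen ?G)"
        using radical_ideal_gen(2)[of ?G] True by (intro binomial_mem_1[of _ b']) auto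
    qed
  next
    case False
    then have "a' \<ge> 2" using a' by simp
    \<comment> \<open>The required bidegrees lie in the cone because i is at most 5, and miss the
      gap because \<open>a'\<close> is not 1.\<close>
    have "\<exists>e. degs e = 2 * a' + (5 - i) * b' \<and> degt e = i * a'" if "i \<le> 5" for i
    proof (rule exists_exponents)
      have "2 * (i * a') \<le> 10 * a'" using that by simp
      then show "2 * (i * a') \<le> 5 * (2 * a' + (5 - i) * b')"
        unfolding distrib_left by (intro trans_le_add1) simp
      show "i * a' \<noteq> 1" using False by simp
    qed
    then obtain e where e: "\<And>i. i \<le> 5 \<Longrightarrow> degs (e i) = 2 * a' + (5 - i) * b'"
      "\<And>i. i \<le> 5 \<Longrightarrow> degt (e i) = i * a'"
      by metis
    show ?thesis
    proof (rule stci)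
      let ?G = "{?x * ?y ^ 3 - ?z ^ 2, ?y ^ 5 - 2 * ?y * ?z * ?w4 + ?x * ?w4 ^ 2, curve_poly indet e}"
      have weight: "a' * degs (e i) + b' * degt (e i) = a' * (2 * a' + 5 * b')" if i: "i \<le> 5" for i
      proof -
        obtain j where j: "5 = i + j" using le_Suc_ex[OF i] by blast
        then have "5 - i = j" by simp
        then show ?thesis unfolding e(1)[OF i] e(2)[OF i] j by (simp add: algebra_simps)
      qed
      have two: "toric_map ?w (2 :: 'a mpoly4) = 2"
        using toric_map_of_nat[of ?w 2] by simp
      \<comment> \<open>All six monomials have the same image, so the alternating sum of binomial
        coefficients factors out and vanishes.\<close>
      have "toric_map ?w (curve_poly indet e :: 'a mpoly4) =
          (\<Sum>i\<le>5. (- 1) ^ i * of_nat (5 choose i)) * monom 1 (g * (a' * (2 * a' + 5 * b')))"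
        unfolding curve_poly_def sum_distrib_right toric_map_sum
        by (rule sum.cong) (simp_all add: toric_map_mult toric_map_power toric_map_of_nat
            toric_map_uminus toric_map_1 mon weight)
      also have "\<dots> = 0" by (subst choose_alternating_sum) simp_all
      finally have "curve_poly indet e \<in> ?I" by (simp add: toric_ideal_def)
      moreover have "?x * ?y ^ 3 - ?z ^ 2 \<in> ?I"
        by (simp add: toric_ideal_def toric_map_diff toric_map_mult toric_map_power toric_map_indet
            monom_power mult_monom row4_def algebra_simps)
      \<comment> \<open>All three monomials have bidegree (5, 10), and the coefficients 1, -2, 1 add
        up to 0.\<close>
      moreover have "?y ^ 5 - 2 * ?y * ?z * ?w4 + ?x * ?w4 ^ 2 \<in> ?I"
        by (simp add: toric_ideal_def toric_map_add toric_map_diff toric_map_mult toric_map_power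
            toric_map_indet two monom_power mult_monom row4_def mult.assoc)
          (simp add: algebra_simps)
      ultimately show "?G \<subseteq> ?I" by blast
      interpret radical_ideal "radical (ideal_gen ?G)" by (rule radical_ideal_gen)
      fix u v assume "a' * degs u + b' * degt u = a' * degs v + b' * degt v"
      then show "mon indet u - mon indet v \<in> radical (ideal_gen ?G)"
        using radical_ideal_gen(2)[of ?G] e cop \<open>a' \<ge> 2\<close> b'
        by (intro binomial_mem[of indet e a' b']) auto
    qed
  qed
qed

end
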